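(* Let $n$ and $\ell$ be positive integers with $\ell\ne n$ and $\ell\ne\frac n2$. Then for all integers $j\ge0$, $$\prod_{m\ge1}\frac{(1+q^{nm})(1+q^{2nm-n(j+2)+2\ell})(1+q^{2nm+nj-2\ell})}{(1-q^{nm})(1-q^{nm+\ell-n})^2(1-q^{nm-\ell})^2}=q^{-\frac j2(jn-2\ell+n)}\sum_{k=|j|}^\infty\binom{2k}{j+k}A_{\ell,n,k}(q).$$
   Context: Here $|q|<1$. For integers $k\ge0$, $$A_{\ell,n,k}(q):=\sum_{\substack{0<m_1<m_2<\cdots<m_k\\ m_i\equiv\pm\ell\ (\mathrm{mod}\ n)\text{ for all }i}}\frac{q^{m_1+m_2+\cdots+m_k}}{(1-q^{m_1})^2(1-q^{m_2})^2\cdots(1-q^{m_k})^2},$$ with $A_{\ell,n,0}(q)=1$.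
   Formalization: The conditions ℓ≠n, ℓ≠n/2 are read modulo n (n divides neither ℓ nor 2ℓ), since ℓ=2n gives a zero denominator and ℓ=3n/2 makes the identity false; q=0 is allowed only for j=0 and ℓ<n, where no negative power of q occurs. *)

theory Defs
  imports "HOL-Analysis.Analysis" "HOL-Number_Theory.Cong"
begin

text \<open>
  The tuples \<open>0 < m\<^sub>1 < \<dots> < m\<^sub>k\<close> with every \<open>m\<^sub>i \<equiv> \<plusminus>l (mod n)\<close>, as strictly increasing
  lists of length \<open>k\<close>. The congruences are over the integers because of \<open>- l\<close>.
\<close>

definition pm_tuples :: "nat \<Rightarrow> nat \<Rightarrow> nat \<Rightarrow> nat list set" where
  "pm_tuples l n k = {ms. length ms = k \<and> sorted_wrt (<) ms \<and>
     (\<forall>m\<in>set ms. 0 < m \<and>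
        ([int m = int l] (mod int n) \<or> [int m = - int l] (mod int n)))}"

text \<open>
  For \<open>k = 0\<close> the only tuple is the empty list and the value is \<open>1\<close>. For \<open>norm q < 1\<close> the
  family is absolutely summable.
\<close>

definition macmahon_A :: "nat \<Rightarrow> nat \<Rightarrow> nat \<Rightarrow> complex \<Rightarrow> complex" where
  "macmahon_A l n k q = (\<Sum>\<^sub>\<infinity>ms\<in>pm_tuples l n k.
     q ^ sum_list ms / (\<Prod>m\<leftarrow>ms. (1 - q ^ m)\<^sup>2))"

text \<open>
  The factor with index \<open>m \<ge> 1\<close> of the infinite product. The integer exponents of \<open>q\<close>
  may be negative.
\<close>

definition prod_factor :: "complex \<Rightarrow> int \<Rightarrow> int \<Rightarrow> int \<Rightarrow> int \<Rightarrow> complex" where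
  "prod_factor q l n j m =
     ((1 + q powi (n * m)) * (1 + q powi (2 * n * m - n * (j + 2) + 2 * l))
        * (1 + q powi (2 * n * m + n * j - 2 * l)))
     / ((1 - q powi (n * m)) * (1 - q powi (n * m + l - n))\<^sup>2 * (1 - q powi (n * m - l))\<^sup>2)"

text \<open>
  The integer \<open>(j/2) (j n - 2 l + n)\<close>: the division by \<open>2\<close> is exact, since
  \<open>j (j n - 2 l + n) = n j (j + 1) - 2 l j\<close>.
\<close>

definition shift_exponent :: "int \<Rightarrow> int \<Rightarrow> int \<Rightarrow> int" where
  "shift_exponent l n j = j * (j * n - 2 * l + n) div 2"

end

theory Submission
  imports Defs
begin

text \<open>
  The sum of \<open>x\<^sup>k\<close> times \<open>macmahon_A l n k q\<close> over all \<open>k\<close> is the product of \<open>1 + x q\<^sup>m / (1 - q\<^sup>m)\<^sup>2\<close> over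
  \<open>m \<equiv> \<plusminus>l (mod n)\<close>. For \<open>x = 2 + z + 1/z\<close> the factor is
  \<open>(1 + z q\<^sup>m) (1 + q\<^sup>m / z) / (1 - q\<^sup>m)\<^sup>2\<close>, so with \<open>Q = q\<^sup>n\<close> and \<open>w = q\<^sup>l\<close> the Jacobi triple product turns
  the generating function into \<open>theta Q (w z) theta Q (w / z) / (theta Q (- w))\<^sup>2\<close>. On the unit circle
  both sides are absolutely convergent Laurent series in \<open>z\<close>; the coefficients of \<open>z\<^sup>j\<close> agree. Since
  \<open>x\<^sup>k = (1 + z)\<^sup>2\<^sup>k / z\<^sup>k\<close>, the left one is the binomial sum. The right one is again a theta series,
  with base \<open>Q\<^sup>2\<close>, because \<open>tri r + tri (r - j) = 2 tri r - j r + tri (- j)\<close>; a second use of the triple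
  product gives the numerator of the product side.
\<close>

section \<open>The Jacobi triple product\<close>

definition tri :: "int \<Rightarrow> int" where
  "tri k = k * (k - 1) div 2"

lemma two_tri: "2 * tri k = k * (k - 1)"
  unfolding tri_def by simp

lemma tri_add_one: "tri (k + 1) = tri k + k"
  using two_tri[of k] two_tri[of "k + 1"] by (simp add: algebra_simps)

lemma tri_one_add: "tri (1 + k) = tri k + k"
  using tri_add_one[of k] by (simp add: add.commute)

lemma tri_add: "tri (r + s) = tri r + tri s + r * s"
  using two_tri[of r] two_tri[of s] two_tri[of "r + s"] by (simp add: algebra_simps)

text \<open>The finite q-Pochhammer symbol (Q; Q)_N.\<close>

definition q_fact :: "complex \<Rightarrow> nat \<Rightarrow> complex" where
  "q_fact Q N = (\<Prod>i<N. 1 - Q ^ Suc i)"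

text \<open>The Gaussian binomial coefficient. An integer lower index with value 0 outside 0..N
  keeps the Pascal rules and the sums over all integers free of boundary cases.\<close>

definition q_binom :: "complex \<Rightarrow> nat \<Rightarrow> int \<Rightarrow> complex" where
  "q_binom Q N k = (if 0 \<le> k \<and> k \<le> int N
     then q_fact Q N / (q_fact Q (nat k) * q_fact Q (N - nat k)) else 0)"

definition theta :: "complex \<Rightarrow> complex \<Rightarrow> complex" where
  "theta Q w = (\<Sum>\<^sub>\<infinity>k\<in>UNIV. Q powi tri k * w powi k)"

text \<open>One factor of the Jacobi product (Q; Q) (-w; Q) (-Q/w; Q), counted from i = 0.\<close>

definition theta_factor :: "complex \<Rightarrow> complex \<Rightarrow> nat \<Rightarrow> complex" where
  "theta_factor Q w i = (1 - Q ^ Suc i) * (1 + w * Q ^ i) * (1 + inverse w * Q ^ Suc i)"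

section \<open>Gaussian binomials and the finite triple product\<close>

lemma power_neq_one:
  fixes Q :: complex
  assumes "norm Q < 1" "n > 0"
  shows "Q ^ n \<noteq> 1"
proof
  assume "Q ^ n = 1"
  hence "norm Q ^ n = 1" by (metis norm_one norm_power)
  moreover have "norm Q ^ n < 1" using assms by (simp add: power_less_one_iff)
  ultimately show False by simp
qed

lemma q_fact_0 [simp]: "q_fact Q 0 = 1"
  by (simp add: q_fact_def)

lemma q_fact_Suc: "q_fact Q (Suc N) = q_fact Q N * (1 - Q ^ Suc N)"
  by (simp add: q_fact_def)

lemma q_fact_nonzero: "norm Q < 1 \<Longrightarrow> q_fact Q N \<noteq> 0"
  using power_neq_one[of Q] by (auto simp: q_fact_def simp del: power_Suc)

lemma q_binom_outside: "k < 0 \<or> k > int N \<Longrightarrow> q_binom Q N k = 0"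
  by (auto simp: q_binom_def)

lemma q_binom_eq: "q_binom Q (i + d) (int i) = q_fact Q (i + d) / (q_fact Q i * q_fact Q d)"
  by (simp add: q_binom_def)

text \<open>Isolates the interior case of the Pascal rules. There i = k - 1 and d = N - k are
  natural numbers, so all q-factorials have explicit arguments.\<close>

lemma q_binom_split:
  obtains "k < 0 \<or> k > int N + 1" | "k = 0" | "k = int N + 1" | i d where "k = int (Suc i)" "N = Suc (i + d)"
proof -
  consider "k < 0 \<or> k > int N + 1" | "k = 0" | "k = int N + 1" | "1 \<le> k" "k \<le> int N" by linarith
  thus ?thesis
  proof cases
    case 4
    have "k = int (Suc (nat (k - 1)))" "N = Suc (nat (k - 1) + (N - nat k))" using 4 by auto
    thus ?thesis using that(4) by blast
  qed (use that in auto)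
qed

text \<open>Comes from 1 - Q^(N+1) = (1 - Q^(N+1-k)) + Q^(N+1-k) (1 - Q^k). This Pascal rule absorbs
  a new factor 1 + w Q^a in \<open>finite_triple_product\<close>.\<close>

lemma q_binom_Suc_upper:
  assumes Q: "norm Q < 1" "Q \<noteq> 0"
  shows "q_binom Q (Suc N) k = q_binom Q N k + Q powi (int N + 1 - k) * q_binom Q N (k - 1)"
proof (cases rule: q_binom_split[of k N])
  case 1
  thus ?thesis by (auto simp: q_binom_outside)
next
  case 2
  thus ?thesis using q_fact_nonzero[OF Q(1)] by (simp add: q_binom_def)
next
  case 3
  thus ?thesis using q_fact_nonzero[OF Q(1)] by (simp add: q_binom_def nat_add_distrib)
next
  case (4 i d)
  have e: "int N + 1 - k = int (Suc d)" using 4 by simp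
  have a: "q_binom Q (Suc N) k = q_fact Q (Suc (Suc (i + d))) / (q_fact Q (Suc i) * q_fact Q (Suc d))"
    using q_binom_eq[of Q "Suc i" "Suc d"] 4 by simp
  have b: "q_binom Q N k = q_fact Q (Suc (i + d)) / (q_fact Q (Suc i) * q_fact Q d)"
    using q_binom_eq[of Q "Suc i" "d"] 4 by simp
  have c: "q_binom Q N (k - 1) = q_fact Q (Suc (i + d)) / (q_fact Q i * q_fact Q (Suc d))"
    using q_binom_eq[of Q "i" "Suc d"] 4 by simp
  have nz: "q_fact Q i \<noteq> 0" "q_fact Q d \<noteq> 0" "1 - Q ^ Suc i \<noteq> 0" "1 - Q ^ Suc d \<noteq> 0"
    using q_fact_nonzero[OF Q(1)] power_neq_one[OF Q(1), of "Suc i"] power_neq_one[OF Q(1), of "Suc d"] by auto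
  have "1 - Q ^ Suc (Suc (i + d)) = (1 - Q ^ Suc d) + Q ^ Suc d * (1 - Q ^ Suc i)"
    by (simp add: algebra_simps power_add)
  thus ?thesis unfolding a b c e power_int_of_nat q_fact_Suc[of Q "Suc (i + d)"] q_fact_Suc[of Q i] q_fact_Suc[of Q d]
    using nz by (simp add: divide_simps del: power_Suc) (simp add: algebra_simps del: power_Suc)
qed

text \<open>The mirror splitting, with k and N + 1 - k exchanged. It absorbs the factors in
  1/w.\<close>

lemma q_binom_Suc_lower:
  assumes Q: "norm Q < 1" "Q \<noteq> 0"
  shows "q_binom Q (Suc N) k = q_binom Q N (k - 1) + Q powi k * q_binom Q N k"
proof (cases rule: q_binom_split[of k N])
  case 1
  thus ?thesis by (auto simp: q_binom_outside)
next
  case 2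
  thus ?thesis using q_fact_nonzero[OF Q(1)] by (simp add: q_binom_def)
next
  case 3
  thus ?thesis using q_fact_nonzero[OF Q(1)] by (simp add: q_binom_def nat_add_distrib)
next
  case (4 i d)
  have a: "q_binom Q (Suc N) k = q_fact Q (Suc (Suc (i + d))) / (q_fact Q (Suc i) * q_fact Q (Suc d))"
    using q_binom_eq[of Q "Suc i" "Suc d"] 4 by simp
  have b: "q_binom Q N k = q_fact Q (Suc (i + d)) / (q_fact Q (Suc i) * q_fact Q d)"
    using q_binom_eq[of Q "Suc i" "d"] 4 by simp
  have c: "q_binom Q N (k - 1) = q_fact Q (Suc (i + d)) / (q_fact Q i * q_fact Q (Suc d))"
    using q_binom_eq[of Q "i" "Suc d"] 4 by simp
  have nz: "q_fact Q i \<noteq> 0" "q_fact Q d \<noteq> 0" "1 - Q ^ Suc i \<noteq> 0" "1 - Q ^ Suc d \<noteq> 0"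
    using q_fact_nonzero[OF Q(1)] power_neq_one[OF Q(1), of "Suc i"] power_neq_one[OF Q(1), of "Suc d"] by auto
  have "1 - Q ^ Suc (Suc (i + d)) = (1 - Q ^ Suc i) + Q ^ Suc i * (1 - Q ^ Suc d)"
    by (simp add: algebra_simps power_add)
  thus ?thesis unfolding a b c unfolding 4(1) power_int_of_nat q_fact_Suc[of Q "Suc (i + d)"] q_fact_Suc[of Q i] q_fact_Suc[of Q d]
    using nz by (simp add: divide_simps del: power_Suc) (simp add: algebra_simps del: power_Suc)
qed

lemma has_sum_shift_int:
  fixes f :: "int \<Rightarrow> 'a :: {comm_monoid_add, topological_space}"
  shows "((\<lambda>k. f (k + c)) has_sum s) UNIV \<longleftrightarrow> (f has_sum s) UNIV"
  by (rule has_sum_reindex_bij_witness[of _ "\<lambda>k. k - c" "\<lambda>k. k + c"]) auto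

text \<open>Induction on b for a = 0, then on a. Multiplication by a new factor adds to the series a
  multiple of its own shift by one, and a Pascal rule merges the two coefficients at each k.\<close>

lemma finite_triple_product:
  assumes Q: "norm Q < 1" "Q \<noteq> 0" and w: "w \<noteq> 0"
  shows "((\<lambda>k. q_binom Q (a + b) (int b + k) * (Q powi tri k * w powi k))
    has_sum ((\<Prod>i<a. 1 + w * Q ^ i) * (\<Prod>i<b. 1 + inverse w * Q ^ Suc i))) UNIV"
proof (induction a)
  case 0
  show ?case
  proof (induction b)
    case 0
    show ?case
      by (rule has_sum_finite_neutralI[of "{0}"]) (auto simp: q_binom_def tri_def)
  next
    case (Suc b)
    let ?f = "\<lambda>k. q_binom Q b (int b + k) * (Q powi tri k * w powi k)"
    let ?p = "\<Prod>i<b. 1 + inverse w * Q ^ Suc i"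
    have f: "(?f has_sum ?p) UNIV" using Suc by simp
    have "((\<lambda>k. ?f k + inverse w * Q ^ Suc b * ?f (k + 1)) has_sum (?p + inverse w * Q ^ Suc b * ?p)) UNIV"
      by (intro has_sum_add has_sum_cmult_right f, subst has_sum_shift_int, rule f)
    moreover have "?f k + inverse w * Q ^ Suc b * ?f (k + 1)
        = q_binom Q (Suc b) (int (Suc b) + k) * (Q powi tri k * w powi k)" for k
    proof -
      have "Q ^ Suc b * Q powi k = Q powi (int (Suc b) + k)"
        using Q by (simp add: power_int_add del: of_nat_Suc power_Suc)
      hence "inverse w * Q ^ Suc b * ?f (k + 1) = Q powi (int (Suc b) + k) * q_binom Q b (int b + k + 1)
          * (Q powi tri k * w powi k)"
        using Q w by (simp add: tri_one_add power_int_add add_ac field_simps del: of_nat_Suc power_Suc)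
      thus ?thesis
        unfolding q_binom_Suc_lower[OF Q] by (simp add: algebra_simps del: power_Suc)
    qed
    ultimately show ?case by (simp add: algebra_simps)
  qed
next
  case (Suc a)
  let ?f = "\<lambda>k. q_binom Q (a + b) (int b + k) * (Q powi tri k * w powi k)"
  let ?p = "(\<Prod>i<a. 1 + w * Q ^ i) * (\<Prod>i<b. 1 + inverse w * Q ^ Suc i)"
  have "((\<lambda>k. ?f k + w * Q ^ a * ?f (k + (-1))) has_sum (?p + w * Q ^ a * ?p)) UNIV"
    by (intro has_sum_add has_sum_cmult_right Suc, subst has_sum_shift_int, rule Suc)
  moreover have "?f k + w * Q ^ a * ?f (k + (-1))
      = q_binom Q (Suc a + b) (int b + k) * (Q powi tri k * w powi k)" for k
  proof -
    have t: "tri k = tri (k - 1) + (k - 1)" using tri_add_one[of "k - 1"] by simp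
    have "Q ^ a = Q powi (int (a + b) + 1 - (int b + k)) * Q powi (k - 1)"
      using Q by (simp add: power_int_add[symmetric])
    hence "w * Q ^ a * ?f (k + (-1)) = Q powi (int (a + b) + 1 - (int b + k)) * q_binom Q (a + b) (int b + k - 1)
        * (Q powi tri k * w powi k)"
      using Q w by (simp add: t power_int_add power_int_diff algebra_simps)
    thus ?thesis
      unfolding add_Suc q_binom_Suc_upper[OF Q] by (simp add: algebra_simps)
  qed
  ultimately show ?case by (simp add: algebra_simps)
qed

section \<open>The limit of the finite triple product\<close>

lemma convergent_prod_one_plus_geometric:
  fixes Q c :: complex
  assumes "norm Q < 1"
  shows "convergent_prod (\<lambda>i. 1 + c * Q ^ i)"
proof (intro abs_convergent_prod_imp_convergent_prod summable_imp_abs_convergent_prod)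
  have "summable (\<lambda>i. norm c * norm Q ^ i)"
    using assms by (intro summable_mult summable_geometric) auto
  thus "summable (\<lambda>i. norm (1 + c * Q ^ i - 1))" by (simp add: norm_mult norm_power)
qed

lemma q_fact_tendsto_nonzero:
  assumes "norm Q < 1"
  obtains p where "q_fact Q \<longlonglongrightarrow> p" "p \<noteq> 0"
proof -
  have c: "convergent_prod (\<lambda>i. 1 - Q ^ Suc i)"
    using convergent_prod_one_plus_geometric[OF assms, of "- Q"] by simp
  have "q_fact Q \<longlonglongrightarrow> (\<Prod>i. 1 - Q ^ Suc i)"
    using has_prod_imp_tendsto'[OF convergent_prod_has_prod[OF c]]
    by (simp add: q_fact_def[abs_def])
  moreover have "(\<Prod>i. 1 - Q ^ Suc i) \<noteq> 0"
    by (rule prodinf_nonzero[OF c]) (use power_neq_one[OF assms, of "Suc _"] in simp)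
  ultimately show ?thesis by (rule that)
qed

text \<open>The ratio of consecutive terms has norm |Q|^k |w|, which tends to 0 for every w.\<close>

lemma theta_summable_nat:
  fixes Q w :: complex
  assumes Q: "norm Q < 1" "Q \<noteq> 0" and w: "w \<noteq> 0"
  shows "summable (\<lambda>k. norm (Q powi tri (int k) * w powi (int k)))"
proof -
  let ?f = "\<lambda>k. norm (Q powi tri (int k) * w powi (int k))"
  have "(\<lambda>k. norm Q ^ k * norm w) \<longlonglongrightarrow> 0 * norm w"
    using Q by (intro tendsto_intros LIMSEQ_power_zero) auto
  hence "\<forall>\<^sub>F k in sequentially. norm Q ^ k * norm w < 1 / 2"
    by (rule order_tendstoD) auto
  then obtain N where N: "\<And>k. k \<ge> N \<Longrightarrow> norm Q ^ k * norm w < 1 / 2"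
    by (auto simp: eventually_sequentially)
  show ?thesis
  proof (rule summable_ratio_test[of "1 / 2" N])
    fix k assume "k \<ge> N"
    have "?f (Suc k) = (norm Q ^ k * norm w) * ?f k"
      using Q w by (simp add: tri_one_add power_int_add norm_mult norm_power norm_power_int)
    also have "\<dots> \<le> 1 / 2 * ?f k"
      using N[OF \<open>k \<ge> N\<close>] by (intro mult_right_mono) auto
    finally show "norm (?f (Suc k)) \<le> 1 / 2 * norm (?f k)" by simp
  qed auto
qed

lemma theta_abs_summable:
  fixes Q w :: complex
  assumes Q: "norm Q < 1" "Q \<noteq> 0" and w: "w \<noteq> 0"
  shows "(\<lambda>k. norm (Q powi tri k * w powi k)) summable_on UNIV"
proof -
  let ?f = "\<lambda>k. norm (Q powi tri k * w powi k)"
  have "(?f \<circ> int) summable_on UNIV"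
    unfolding o_def using theta_summable_nat[OF assms] by (intro norm_summable_imp_summable_on) simp
  hence 1: "?f summable_on range int"
    by (subst summable_on_reindex) auto
  \<comment> \<open>Reflection k -> -k turns the negative half of the series into a nonnegative half
    with w replaced by Q / w.\<close>
  have "?f (- int k) = norm (Q powi tri (int k) * (Q * inverse w) powi (int k))" for k
  proof -
    have "tri (- int k) = tri (int k) + int k"
      using two_tri[of "int k"] two_tri[of "- int k"] by (simp add: algebra_simps)
    thus ?thesis using Q by (simp add: power_int_add power_int_mult_distrib power_int_minus norm_mult
        norm_power norm_inverse power_inverse power_mult_distrib)
  qed
  hence "(?f \<circ> (\<lambda>k. - int k)) summable_on UNIV"
    unfolding o_def using theta_summable_nat[OF Q, of "Q * inverse w"] Q w
    by (intro norm_summable_imp_summable_on) (simp del: power_int_of_nat)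
  hence 2: "?f summable_on range (\<lambda>k. - int k)"
    by (subst summable_on_reindex) (auto simp: inj_on_def)
  have "k \<in> range int \<union> range (\<lambda>k. - int k)" for k
    by (cases k rule: int_cases2) auto
  hence "UNIV = range int \<union> range (\<lambda>k. - int k)" by blast
  thus ?thesis using summable_on_union[OF 1 2] by simp
qed

lemma theta_has_sum:
  assumes "norm Q < 1" "Q \<noteq> 0" "w \<noteq> 0"
  shows "((\<lambda>k. Q powi tri k * w powi k) has_sum theta Q w) UNIV"
  unfolding theta_def by (rule has_sum_infsum, rule abs_summable_summable, rule theta_abs_summable[OF assms])

lemma prod_theta_factor:
  "(\<Prod>i<M. theta_factor Q w i)
    = q_fact Q M * ((\<Prod>i<M. 1 + w * Q ^ i) * (\<Prod>i<M. 1 + inverse w * Q ^ Suc i))"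
  by (simp add: theta_factor_def q_fact_def prod.distrib mult.assoc)

text \<open>The finite identity with a = b = M is multiplied by \<open>q_fact Q M\<close>. Each
  coefficient then tends to 1, with a bound uniform in M and k, so the limit can be taken term by
  term.\<close>

theorem jacobi_triple_product:
  assumes Q: "norm Q < 1" "Q \<noteq> 0" and w: "w \<noteq> 0"
  shows "(\<lambda>M. \<Prod>i<M. theta_factor Q w i) \<longlonglongrightarrow> theta Q w"
proof -
  obtain p where p: "q_fact Q \<longlonglongrightarrow> p" "p \<noteq> 0"
    using q_fact_tendsto_nonzero[OF Q(1)] .
  obtain B where B: "B > 0" "\<And>N. norm (q_fact Q N) \<le> B"
    using convergent_imp_Bseq[of "q_fact Q"] p by (auto simp: Bseq_def convergent_def)
  have "(\<lambda>N. inverse (q_fact Q N)) \<longlonglongrightarrow> inverse p" using p by (intro tendsto_intros)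
  then obtain C where C: "C > 0" "\<And>N. norm (inverse (q_fact Q N)) \<le> C"
    using convergent_imp_Bseq[of "\<lambda>N. inverse (q_fact Q N)"] by (auto simp: Bseq_def convergent_def)
  define g where "g = (\<lambda>M k. q_fact Q M * q_binom Q (M + M) (int M + k))"
  define h where "h = (\<lambda>k. Q powi tri k * w powi k)"
  \<comment> \<open>A nonzero coefficient is a product of two q-factorials and two inverses of
    q-factorials, hence this bound.\<close>
  have g_le: "norm (g M k) \<le> B * B * C * C" for M k
  proof (cases "0 \<le> int M + k \<and> int M + k \<le> int (M + M)")
    case True
    let ?i = "nat (int M + k)"
    have "norm (g M k) = norm (q_fact Q M) * norm (q_fact Q (M + M)) * norm (inverse (q_fact Q ?i))
        * norm (inverse (q_fact Q (M + M - ?i)))"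
      using True by (simp add: g_def q_binom_def norm_mult norm_divide divide_inverse norm_inverse)
    also have "\<dots> \<le> B * B * C * C"
      using B C by (intro mult_mono) auto
    finally show ?thesis .
  next
    case False
    thus ?thesis using B C by (auto simp: g_def q_binom_outside)
  qed
  have g_lim: "(\<lambda>M. g M k) \<longlonglongrightarrow> 1" for k
  proof -
    \<comment> \<open>As 2M - (M + k) = M - k, both lower q-factorials have arguments tending to
      infinity. All four q-factorials tend to p, and p * p / (p * p) = 1.\<close>
    have i: "filterlim (\<lambda>M. nat (int M + c)) at_top sequentially" for c
    proof (unfold filterlim_at_top, intro allI)
      show "\<forall>\<^sub>F M in sequentially. Z \<le> nat (int M + c)" for Z
        using eventually_ge_at_top[of "Z + nat \<bar>c\<bar>"] by eventually_elim linarith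
    qed
    have "filterlim (\<lambda>M::nat. M + M) at_top sequentially"
      by (rule filterlim_at_top_mono[OF filterlim_ident]) simp
    from filterlim_compose[OF p(1) this] have "(\<lambda>M. q_fact Q M * (q_fact Q (M + M) / (q_fact Q (nat (int M + k)) * q_fact Q (nat (int M + (- k))))))
        \<longlonglongrightarrow> p * (p / (p * p))"
      using p(2) by (intro tendsto_mult tendsto_divide p(1) filterlim_compose[OF p(1) i]) auto
    moreover have "\<forall>\<^sub>F M in sequentially. q_fact Q M * (q_fact Q (M + M) / (q_fact Q (nat (int M + k)) * q_fact Q (nat (int M + (- k))))) = g M k"
      using eventually_ge_at_top[of "nat \<bar>k\<bar>"]
    proof eventually_elim
      case (elim M)
      hence "M + M - nat (int M + k) = nat (int M + (- k))" "0 \<le> int M + k" "int M + k \<le> int (M + M)"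
        by linarith+
      thus ?case unfolding g_def q_binom_def by simp
    qed
    ultimately show ?thesis using p by (simp add: tendsto_cong)
  qed
  have partial: "((\<lambda>k. g M k * h k) has_sum (\<Prod>i<M. theta_factor Q w i)) UNIV" for M
    using has_sum_cmult_right[OF finite_triple_product[OF Q w, of M M], of "q_fact Q M"]
    by (simp add: prod_theta_factor g_def h_def mult.assoc)
  \<comment> \<open>Convergence of the series is uniform in \<open>M\<close>, which permits the
    exchange of the limits in \<open>M\<close> and in the finite sets \<open>X\<close>.\<close>
  have "uniform_limit UNIV (\<lambda>X M. \<Sum>k\<in>X. g M k * h k) (\<lambda>M. \<Prod>i<M. theta_factor Q w i) (finite_subsets_at_top UNIV)"
  proof (rule Weierstrass_m_test_general')
    show "norm (g M k * h k) \<le> B * B * C * C * norm (h k)" for M k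
      unfolding norm_mult[of "g M k"] by (intro mult_right_mono g_le) auto
    show "(\<lambda>k. B * B * C * C * norm (h k)) summable_on UNIV"
      unfolding h_def by (intro summable_on_cmult_right theta_abs_summable assms)
  qed (use partial in auto)
  thus ?thesis
  proof (rule swap_uniform_limit'[rotated 2])
    show "\<forall>\<^sub>F X in finite_subsets_at_top UNIV. (\<lambda>M. \<Sum>k\<in>X. g M k * h k) \<longlonglongrightarrow> (\<Sum>k\<in>X. 1 * h k)"
      by (intro always_eventually allI tendsto_intros g_lim)
    show "((\<lambda>X. \<Sum>k\<in>X. 1 * h k) \<longlongrightarrow> theta Q w) (finite_subsets_at_top UNIV)"
      using theta_has_sum[OF assms] by (simp add: has_sum_def h_def)
  qed auto
qed

text \<open>Partial products with nonzero factors might still tend to 0;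
  \<open>convergent_prod\<close> excludes this.\<close>

lemma theta_nonzero:
  assumes Q: "norm Q < 1" "Q \<noteq> 0" and w: "w \<noteq> 0" and nz: "\<And>i. theta_factor Q w i \<noteq> 0"
  shows "theta Q w \<noteq> 0"
proof -
  have "convergent_prod (\<lambda>i. (1 + (- Q) * Q ^ i) * (1 + w * Q ^ i) * (1 + (inverse w * Q) * Q ^ i))"
    using Q by (intro convergent_prod_mult convergent_prod_one_plus_geometric)
  hence c: "convergent_prod (theta_factor Q w)"
    by (simp add: theta_factor_def[abs_def] mult_ac)
  have "theta Q w = prodinf (theta_factor Q w)"
    using has_prod_imp_tendsto'[OF convergent_prod_has_prod[OF c]] jacobi_triple_product[OF assms(1-3)]
    by (rule LIMSEQ_unique[symmetric])
  thus ?thesis using prodinf_nonzero[OF c nz] by simp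
qed

lemma theta_shift:
  assumes Q: "norm Q < 1" "Q \<noteq> 0" and w: "w \<noteq> 0"
  shows "theta Q (w * Q) = inverse w * theta Q w"
  unfolding theta_def[of Q "w * Q"]
proof (rule infsumI)
  have "((\<lambda>k. inverse w * (Q powi tri (k + 1) * w powi (k + 1))) has_sum (inverse w * theta Q w)) UNIV"
    using theta_has_sum[OF assms] by (intro has_sum_cmult_right) (subst has_sum_shift_int)
  moreover have "inverse w * (Q powi tri (k + 1) * w powi (k + 1)) = Q powi tri k * (w * Q) powi k" for k
    using Q w by (simp add: tri_add_one power_int_add power_int_mult_distrib)
  ultimately show "((\<lambda>k. Q powi tri k * (w * Q) powi k) has_sum (inverse w * theta Q w)) UNIV"
    by simp
qed

section \<open>Fourier coefficients and sums over finite subsets\<close>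

text \<open>The integral depends only on the values of F on the unit circle, so two Laurent
  expansions of F there have the same coefficients. This is how the two expansions of
  \<open>gen_fun\<close> are compared.\<close>

definition fourier_coeff :: "(complex \<Rightarrow> complex) \<Rightarrow> int \<Rightarrow> complex" where
  "fourier_coeff F j = integral {0..2 * pi} (\<lambda>t. F (cis t) * cis (- (of_int j * t))) / (2 * pi)"

lemma has_integral_cis_int:
  "((\<lambda>t. cis (of_int m * t)) has_integral (if m = 0 then 2 * pi else 0)) {0..2 * pi}"
proof (cases "m = 0")
  case True
  thus ?thesis using has_integral_const_real[of "1::complex" 0 "2 * pi"]
    by (simp add: scaleR_conv_of_real)
next
  case False
  have e: "of_int m * \<i> * E / (\<i> * of_int m) = E" for E :: complex
    by (subst mult.commute[of "of_int m"], rule nonzero_mult_div_cancel_left) (use False in simp)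
  let ?F = "\<lambda>t. cis (of_int m * t) / (\<i> * of_int m)"
  have "((\<lambda>t. cis (of_int m * t)) has_integral (?F (2 * pi) - ?F 0)) {0..2 * pi}"
  proof (rule fundamental_theorem_of_calculus)
    fix t :: real
    have "(?F has_vector_derivative
        (of_int m * \<i> * exp (\<i> * (of_int m * of_real t))) / (\<i> * of_int m)) (at t within {0..2 * pi})"
      unfolding cis_conv_exp of_real_mult of_real_of_int_eq
      by (rule has_vector_derivative_real_field) (auto intro!: derivative_eq_intros simp: mult.left_commute mult.commute)
    thus "(?F has_vector_derivative cis (of_int m * t)) (at t within {0..2 * pi})"
      unfolding e by (simp add: cis_conv_exp)
  qed simp
  moreover have "cis (of_int m * (2 * pi)) = 1"
    using cis_multiple_2pi[of "of_int m"] by (simp add: mult_ac)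
  ultimately show ?thesis using False by simp
qed

text \<open>Uniform convergence allows termwise integration, and orthogonality kills every term
  whose exponent is not j. The index set is arbitrary and \<open>e\<close> need not be injective:
  for double series a coefficient is itself a sum over a fibre.\<close>

lemma has_sum_fourier_coeff:
  fixes a :: "'i \<Rightarrow> complex" and e :: "'i \<Rightarrow> int"
  assumes summable: "(\<lambda>i. norm (a i)) summable_on I"
    and F: "\<And>z. norm z = 1 \<Longrightarrow> ((\<lambda>i. a i * z powi e i) has_sum F z) I"
  shows "(a has_sum fourier_coeff F j) {i \<in> I. e i = j}"
proof -
  let ?f = "\<lambda>i t. a i * cis (of_int (e i - j) * t)"
  have "uniform_limit {0..2 * pi} (\<lambda>X t. \<Sum>i\<in>X. ?f i t) (\<lambda>t. F (cis t) * cis (- (of_int j * t)))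
      (finite_subsets_at_top I)"
  proof (rule Weierstrass_m_test_general')
    show "((\<lambda>i. ?f i t) has_sum (F (cis t) * cis (- (of_int j * t)))) I" for t
      using has_sum_cmult_left[OF F[of "cis t"], of "cis (- (of_int j * t))"]
      by (simp add: cis_power_int cis_mult mult.assoc algebra_simps)
  qed (use summable in \<open>auto simp: norm_mult\<close>)
  then obtain K J where K: "\<And>X. ((\<lambda>t. \<Sum>i\<in>X. ?f i t) has_integral K X) {0..2 * pi}"
    and J: "((\<lambda>t. F (cis t) * cis (- (of_int j * t))) has_integral J) {0..2 * pi}"
    and lim: "(K \<longlongrightarrow> J) (finite_subsets_at_top I)"
    by (rule uniform_limit_integral) (auto intro!: continuous_intros)
  let ?g = "\<lambda>i. if e i = j then a i else 0"
  have "K X / (2 * pi) = (\<Sum>i\<in>X. ?g i)" for X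
  proof (cases "finite X")
    case True
    have "((\<lambda>t. \<Sum>i\<in>X. ?f i t) has_integral (\<Sum>i\<in>X. a i * (if e i - j = 0 then 2 * pi else 0))) {0..2 * pi}"
      by (intro has_integral_sum True has_integral_mult_right has_integral_cis_int)
    hence "K X = (\<Sum>i\<in>X. a i * (if e i - j = 0 then 2 * pi else 0))"
      using K has_integral_unique by blast
    also have "\<dots> / (2 * pi) = (\<Sum>i\<in>X. ?g i)"
      unfolding sum_divide_distrib by (intro sum.cong) auto
    finally show ?thesis .
  next
    \<comment> \<open>For infinite \<open>X\<close> both sums are 0 by convention.\<close>
    case False
    thus ?thesis using K[of X] by (simp add: has_integral_0_eq)
  qed
  hence "((\<lambda>X. \<Sum>i\<in>X. ?g i) \<longlongrightarrow> J / (2 * pi)) (finite_subsets_at_top I)"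
    using tendsto_divide[OF lim tendsto_const[of "complex_of_real (2 * pi)"]] by simp
  moreover have "J / (2 * pi) = fourier_coeff F j"
    using J by (simp add: fourier_coeff_def integral_unique)
  ultimately have "(?g has_sum fourier_coeff F j) I"
    by (simp add: has_sum_def)
  thus ?thesis
    by (subst has_sum_cong_neutral[of _ _ ?g]) auto
qed

section \<open>Expansion of infinite products over finite subsets\<close>

lemma abs_summable_prod_subsets:
  fixes f :: "'a \<Rightarrow> complex"
  assumes f: "(\<lambda>m. norm (f m)) summable_on S"
  shows "(\<lambda>T. norm (\<Prod>m\<in>T. f m)) summable_on Fpow S"
proof (rule nonneg_bdd_above_summable_on)
  show "bdd_above (sum (\<lambda>T. norm (\<Prod>m\<in>T. f m)) ` {X. X \<subseteq> Fpow S \<and> finite X})"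
  proof (rule bdd_aboveI2)
    fix X assume X: "X \<in> {X. X \<subseteq> Fpow S \<and> finite X}"
    \<comment> \<open>A finite family of finite sets lies in the power set of its union. There the
      sum is a product of factors 1 + norm (f m), and 1 + x <= exp x bounds it independently of
      \<open>X\<close>.\<close>
    define U where "U = \<Union>X"
    have U: "finite U" "U \<subseteq> S" "X \<subseteq> Pow U"
      using X by (auto simp: U_def Fpow_def)
    have "(\<Sum>T\<in>X. norm (\<Prod>m\<in>T. f m)) \<le> (\<Sum>T\<in>Pow U. norm (\<Prod>m\<in>T. f m))"
      using U by (intro sum_mono2) auto
    also have "\<dots> = (\<Prod>m\<in>U. norm (f m) + 1)"
      using U(1) by (simp add: prod_add prod_norm)
    also have "\<dots> \<le> exp (\<Sum>m\<in>U. norm (f m))"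
      unfolding exp_sum[OF U(1)] by (intro prod_mono) (auto simp: add.commute)
    also have "\<dots> \<le> exp (\<Sum>\<^sub>\<infinity>m\<in>S. norm (f m))"
      using U f by (simp add: finite_sum_le_infsum)
    finally show "(\<Sum>T\<in>X. norm (\<Prod>m\<in>T. f m)) \<le> exp (\<Sum>\<^sub>\<infinity>m\<in>S. norm (f m))" .
  qed
qed simp

text \<open>The unordered sum exists by absolute summability, so it can be evaluated along the
  exhausting families \<open>Pow (A M)\<close>, on which it is a finite product.\<close>

lemma has_sum_prod_subsets:
  fixes f :: "'a \<Rightarrow> complex"
  assumes f: "(\<lambda>m. norm (f m)) summable_on S"
    and A: "\<And>M. finite (A M)" "incseq A" "(\<Union>M. A M) = S"
    and lim: "(\<lambda>M. \<Prod>m\<in>A M. 1 + f m) \<longlonglongrightarrow> L"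
  shows "((\<lambda>T. \<Prod>m\<in>T. f m) has_sum L) (Fpow S)"
proof -
  define s where "s = (\<Sum>\<^sub>\<infinity>T\<in>Fpow S. \<Prod>m\<in>T. f m)"
  have s: "((\<lambda>T. \<Prod>m\<in>T. f m) has_sum s) (Fpow S)"
    unfolding s_def by (rule has_sum_infsum, rule abs_summable_summable, rule abs_summable_prod_subsets[OF f])
  \<comment> \<open>A finite family \<open>X\<close> involves only finitely many points of
    \<open>S\<close>, and all of them lie in \<open>A M\<close> for large \<open>M\<close>.\<close>
  have "filterlim (\<lambda>M. Pow (A M)) (finite_subsets_at_top (Fpow S)) sequentially"
    unfolding filterlim_finite_subsets_at_top
  proof safe
    fix X assume X: "finite X" "X \<subseteq> Fpow S"
    have "\<forall>\<^sub>F M in sequentially. \<forall>x\<in>\<Union>X. x \<in> A M"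
    proof (rule eventually_ball_finite)
      show "finite (\<Union>X)" using X by (auto simp: Fpow_def)
      show "\<forall>x\<in>\<Union>X. \<forall>\<^sub>F M in sequentially. x \<in> A M"
      proof
        fix x assume "x \<in> \<Union>X"
        hence "x \<in> (\<Union>M. A M)" using X A(3) by (auto simp: Fpow_def)
        then obtain N where "x \<in> A N" by blast
        thus "\<forall>\<^sub>F M in sequentially. x \<in> A M"
          using A(2) by (auto simp: eventually_sequentially incseq_def)
      qed
    qed
    thus "\<forall>\<^sub>F M in sequentially. finite (Pow (A M)) \<and> X \<subseteq> Pow (A M) \<and> Pow (A M) \<subseteq> Fpow S"
    proof eventually_elim
      case (elim M)
      have "A M \<subseteq> S" using A(3) by blast
      thus ?case using elim A(1)[of M] by (auto simp: Fpow_def intro: finite_subset)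
    qed
  qed
  with s have "(\<lambda>M. \<Sum>T\<in>Pow (A M). \<Prod>m\<in>T. f m) \<longlonglongrightarrow> s"
    unfolding has_sum_def by (rule filterlim_compose)
  moreover have "(\<Sum>T\<in>Pow (A M). \<Prod>m\<in>T. f m) = (\<Prod>m\<in>A M. 1 + f m)" for M
    using prod_add[OF A(1), of f "\<lambda>_. 1" M] by (simp add: add.commute)
  ultimately have "s = L" using lim LIMSEQ_unique by simp
  thus ?thesis using s by simp
qed

section \<open>The generating function\<close>

definition pm_parts :: "nat \<Rightarrow> nat \<Rightarrow> nat set" where
  "pm_parts l n = {m. 0 < m \<and> ([int m = int l] (mod int n) \<or> [int m = - int l] (mod int n))}"

definition part_weight :: "complex \<Rightarrow> nat \<Rightarrow> complex" where
  "part_weight q m = q ^ m / (1 - q ^ m)\<^sup>2"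

lemma part_weight_abs_summable:
  assumes q: "norm q < 1"
  shows "(\<lambda>m. norm (c * part_weight q m)) summable_on S"
proof -
  have le: "norm (c * part_weight q m) \<le> norm c * (norm q ^ m / (1 - norm q)\<^sup>2)" for m
  proof (cases "m = 0")
    \<comment> \<open>At m = 0 the denominator is 0 and the quotient is 0 by convention.\<close>
    case True
    thus ?thesis by (simp add: part_weight_def)
  next
    case False
    have "norm q ^ m \<le> norm q"
      using power_decreasing[of 1 m "norm q"] q False by simp
    hence "1 - norm q \<le> norm (1 - q ^ m)"
      using norm_triangle_ineq2[of 1 "q ^ m"] by (simp add: norm_power)
    hence "(1 - norm q)\<^sup>2 \<le> norm (1 - q ^ m) ^ 2"
      using q by (intro power_mono) auto
    moreover have "0 < (1 - norm q)\<^sup>2" using q by simp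
    ultimately have "norm q ^ m / norm (1 - q ^ m) ^ 2 \<le> norm q ^ m / (1 - norm q)\<^sup>2"
      by (intro divide_left_mono mult_pos_pos) auto
    hence "norm (part_weight q m) \<le> norm q ^ m / (1 - norm q)\<^sup>2"
      by (simp add: part_weight_def norm_divide norm_power)
    thus ?thesis unfolding norm_mult by (rule mult_left_mono) simp
  qed
  have "(\<lambda>m. norm c * (norm q ^ m / (1 - norm q)\<^sup>2)) summable_on UNIV"
    using q by (intro norm_summable_imp_summable_on)
      (auto simp: norm_mult norm_divide norm_power intro!: summable_mult summable_divide summable_geometric)
  hence "(\<lambda>m. norm (c * part_weight q m)) summable_on UNIV"
    by (rule Infinite_Sum.abs_summable_on_comparison_test') (rule le)
  thus ?thesis by (rule summable_on_subset_banach) simp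
qed

text \<open>Replaces tuples by finite sets of parts, the index set of the subset expansion of a
  product.\<close>

lemma bij_betw_set_pm_tuples:
  "bij_betw set (pm_tuples l n k) {T \<in> Fpow (pm_parts l n). card T = k}"
proof (rule bij_betwI[of _ _ _ sorted_list_of_set])
  show "set \<in> pm_tuples l n k \<rightarrow> {T \<in> Fpow (pm_parts l n). card T = k}"
    by (auto simp: pm_tuples_def pm_parts_def Fpow_def strict_sorted_iff distinct_card)
  show "sorted_list_of_set \<in> {T \<in> Fpow (pm_parts l n). card T = k} \<rightarrow> pm_tuples l n k"
    by (auto simp: pm_tuples_def pm_parts_def Fpow_def)
  show "sorted_list_of_set (set ms) = ms" if "ms \<in> pm_tuples l n k" for ms
    using that by (simp add: pm_tuples_def strict_sorted_iff sorted_list_of_set.idem_if_sorted_distinct)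
  show "set (sorted_list_of_set T) = T" if "T \<in> {T \<in> Fpow (pm_parts l n). card T = k}" for T
    using that by (auto simp: Fpow_def)
qed

lemma macmahon_A_has_sum:
  assumes q: "norm q < 1"
  shows "((\<lambda>T. \<Prod>m\<in>T. part_weight q m) has_sum macmahon_A l n k q)
    {T \<in> Fpow (pm_parts l n). card T = k}"
proof -
  let ?B = "{T \<in> Fpow (pm_parts l n). card T = k}"
  have "(\<lambda>T. norm (\<Prod>m\<in>T. part_weight q m)) summable_on Fpow (pm_parts l n)"
    using part_weight_abs_summable[OF q, of 1] by (intro abs_summable_prod_subsets) simp
  hence "(\<lambda>T. norm (\<Prod>m\<in>T. part_weight q m)) summable_on ?B"
    by (rule summable_on_subset_banach) auto
  hence "((\<lambda>T. \<Prod>m\<in>T. part_weight q m) has_sum (\<Sum>\<^sub>\<infinity>T\<in>?B. \<Prod>m\<in>T. part_weight q m)) ?B"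
    by (intro has_sum_infsum) (rule abs_summable_summable)
  also have "(\<Sum>\<^sub>\<infinity>T\<in>?B. \<Prod>m\<in>T. part_weight q m)
      = (\<Sum>\<^sub>\<infinity>ms\<in>pm_tuples l n k. \<Prod>m\<in>set ms. part_weight q m)"
    by (rule infsum_reindex_bij_betw[OF bij_betw_set_pm_tuples, symmetric])
  also have "\<dots> = macmahon_A l n k q"
    unfolding macmahon_A_def
  proof (rule infsum_cong)
    fix ms assume "ms \<in> pm_tuples l n k"
    hence d: "distinct ms" by (simp add: pm_tuples_def strict_sorted_iff)
    hence "sum_list ms = (\<Sum>m\<in>set ms. m)"
      using sum.distinct_set_conv_list[OF d, of "\<lambda>m. m"] by simp
    thus "(\<Prod>m\<in>set ms. part_weight q m) = q ^ sum_list ms / (\<Prod>m\<leftarrow>ms. (1 - q ^ m)\<^sup>2)"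
      by (simp add: part_weight_def prod_dividef power_sum prod.distinct_set_conv_list[OF d, symmetric])
  qed
  finally show ?thesis .
qed

section \<open>Enumeration of the parts by residue class\<close>

lemma pm_parts_mod: "pm_parts (l mod n) n = pm_parts l n"
proof -
  have "[int (l mod n) = int l] (mod int n)" by (simp add: cong_def zmod_int)
  moreover have "[- int (l mod n) = - int l] (mod int n)"
    using calculation by (simp add: cong_minus_minus_iff)
  ultimately have "[int m = int (l mod n)] (mod int n) \<longleftrightarrow> [int m = int l] (mod int n)"
    "[int m = - int (l mod n)] (mod int n) \<longleftrightarrow> [int m = - int l] (mod int n)" for m
    by (metis cong_sym cong_trans)+
  thus ?thesis by (simp add: pm_parts_def)
qed

text \<open>Used for 0 < r < n. The index i pairs n i + r with n (i + 1) - r, the two exponents of q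
  that occur in one theta factor with Q = q^n and w = q^r.\<close>

definition pm_parts_upto :: "nat \<Rightarrow> nat \<Rightarrow> nat \<Rightarrow> nat set" where
  "pm_parts_upto r n M = (\<lambda>i. n * i + r) ` {..<M} \<union> (\<lambda>i. n * Suc i - r) ` {..<M}"

lemma Union_pm_parts_upto:
  assumes r: "0 < r" "r < n"
  shows "(\<Union>M. pm_parts_upto r n M) = pm_parts r n"
proof (intro equalityI subsetI)
  fix m assume "m \<in> (\<Union>M. pm_parts_upto r n M)"
  then obtain i where "m = n * i + r \<or> m = n * Suc i - r"
    by (auto simp: pm_parts_upto_def)
  thus "m \<in> pm_parts r n"
  proof
    assume "m = n * i + r"
    thus ?thesis using r by (simp add: pm_parts_def cong_def)
  next
    assume m: "m = n * Suc i - r"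
    have "n \<le> n * Suc i" by simp
    hence "r < n * Suc i" using r by linarith
    hence "0 < m" "int m = - int r + int n * int (Suc i)" unfolding m by (simp_all add: of_nat_diff algebra_simps)
    moreover have "(- int r + int n * int (Suc i)) mod int n = - int r mod int n"
      by (rule mod_mult_self2)
    ultimately show ?thesis by (auto simp: pm_parts_def cong_def)
  qed
next
  fix m assume m: "m \<in> pm_parts r n"
  have "\<exists>i. m = n * i + r \<or> m = n * Suc i - r"
  proof (cases "[int m = int r] (mod int n)")
    case True
    hence "m mod n = r" using r by (simp only: cong_int_iff) (simp add: cong_def)
    hence "m = n * (m div n) + r" by (metis mult_div_mod_eq)
    thus ?thesis by blast
  next
    case False
    hence "[int m + int r = - int r + int r] (mod int n)"
      using m by (intro cong_add) (auto simp: pm_parts_def)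
    hence "n dvd m + r"
      by (simp add: cong_0_iff flip: of_nat_add)
    then obtain c where c: "m + r = n * c" by blast
    then obtain i where "c = Suc i" using r by (cases c) auto
    hence "m = n * Suc i - r" using c by simp
    thus ?thesis by blast
  qed
  then obtain i where "m = n * i + r \<or> m = n * Suc i - r" by blast
  hence "m \<in> pm_parts_upto r n (Suc i)" by (auto simp: pm_parts_upto_def)
  thus "m \<in> (\<Union>M. pm_parts_upto r n M)" by blast
qed

lemma prod_pm_parts_upto:
  assumes r: "0 < r" "r < n" "2 * r \<noteq> n"
  shows "(\<Prod>m\<in>pm_parts_upto r n M. f m) = (\<Prod>i<M. f (n * i + r) * f (n * Suc i - r))"
proof -
  have "inj_on (\<lambda>i. n * i + r) {..<M}" using r by (auto simp: inj_on_def)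
  moreover have "inj_on (\<lambda>i. n * Suc i - r) {..<M}"
  proof (rule inj_onI)
    fix i j assume "n * Suc i - r = n * Suc j - r"
    moreover have "n \<le> n * Suc i" "n \<le> n * Suc j" by simp_all
    ultimately have "n * Suc i = n * Suc j" using r by linarith
    thus "i = j" using r by simp
  qed
  \<comment> \<open>A common value would give that n divides 2 r, and 0 < 2 r < 2 n then forces 2 r
    = n. Disjointness lets every i contribute two separate factors.\<close>
  moreover have "n * i + r \<noteq> n * Suc j - r" for i j
  proof
    assume "n * i + r = n * Suc j - r"
    moreover have "n \<le> n * Suc j" by simp
    ultimately have e: "n * i + 2 * r = n * Suc j" using r by linarith
    hence "n dvd 2 * r" by (metis dvd_add_right_iff dvd_triv_left)
    then obtain c where "2 * r = n * c" by blast
    moreover have "c < 2" using r calculation by (metis mult_less_cancel1 mult.commute nat_mult_less_cancel1 zero_less_numeral less_trans)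
    ultimately show False using r by (cases c) auto
  qed
  hence "(\<lambda>i. n * i + r) ` {..<M} \<inter> (\<lambda>i. n * Suc i - r) ` {..<M} = {}" by blast
  ultimately show ?thesis
    by (simp add: pm_parts_upto_def prod.union_disjoint prod.reindex prod.distrib del: mult_Suc_right)
qed

definition gen_fun :: "complex \<Rightarrow> complex \<Rightarrow> complex \<Rightarrow> complex" where
  "gen_fun Q w z = theta Q (w * z) * theta Q (w * inverse z) / (theta Q (- w))\<^sup>2"

lemma power_int_neq_one:
  fixes q :: complex
  assumes "norm q < 1" "q \<noteq> 0" "k \<noteq> 0"
  shows "q powi k \<noteq> 1"
  using power_neq_one[OF assms(1), of "nat k"] power_neq_one[OF assms(1), of "nat (- k)"] assms
  by (cases "k > 0") (auto simp: power_int_def power_inverse)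

text \<open>A factor could vanish only if l + n i or n (i + 1) - l were 0, which would make l a
  multiple of n.\<close>

lemma theta_factor_minus_nonzero:
  fixes q :: complex
  assumes q: "norm q < 1" "q \<noteq> 0" and n: "0 < n" and l: "\<not> int n dvd l"
  shows "theta_factor (q ^ n) (- (q powi l)) i \<noteq> 0"
proof -
  have "q powi l * (q ^ n) ^ i = q powi (l + int (n * i))"
    using q by (simp add: power_int_add flip: power_mult of_nat_mult)
  moreover have "inverse (q powi l) * (q ^ n) ^ Suc i = q powi (int (n * Suc i) - l)"
    using q by (simp add: power_int_diff divide_inverse mult.commute power_mult del: power_Suc of_nat_mult of_nat_Suc mult_Suc_right)
  moreover have "l + int (n * i) \<noteq> 0" "int (n * Suc i) - l \<noteq> 0"
    using l by (metis add_eq_0_iff dvd_minus_iff dvd_triv_left of_nat_mult, metis diff_eq_eq add_0 dvd_triv_left of_nat_mult)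
  ultimately show ?thesis
    using power_int_neq_one[OF q] power_neq_one[OF q(1), of "n * Suc i"] n
    by (simp add: theta_factor_def power_mult del: power_Suc mult_Suc_right)
qed

lemma theta_minus_nonzero:
  assumes q: "norm q < 1" "q \<noteq> 0" and n: "0 < n" and l: "\<not> int n dvd l"
  shows "theta (q ^ n) (- (q powi l)) \<noteq> 0"
  using assms theta_factor_minus_nonzero[OF assms] 
  by (intro theta_nonzero) (auto simp: norm_power power_less_one_iff)

text \<open>By \<open>theta_shift\<close>, replacing w by w Q multiplies numerator and denominator
  alike by w^(-2). Hence for w = q^l the function depends only on l modulo n.\<close>

lemma gen_fun_shift:
  assumes "norm Q < 1" "Q \<noteq> 0" "w \<noteq> 0" "z \<noteq> 0"
  shows "gen_fun Q (w * Q ^ s) z = gen_fun Q w z"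
proof (induction s)
  case (Suc s)
  have 1: "gen_fun Q (v * Q) z = gen_fun Q v z" if "v \<noteq> 0" for v
  proof -
    have e: "theta Q (v * Q * z) = inverse (v * z) * theta Q (v * z)"
      "theta Q (v * Q * inverse z) = inverse (v * inverse z) * theta Q (v * inverse z)"
      "theta Q (- (v * Q)) = inverse (- v) * theta Q (- v)"
      using theta_shift[of Q "v * z"] theta_shift[of Q "v * inverse z"] theta_shift[of Q "- v"] assms that
      by (simp_all add: mult_ac)
    \<comment> \<open>If the denominator vanishes, both quotients are 0 by convention.\<close>
    show ?thesis unfolding gen_fun_def e using assms that
      by (cases "theta Q (- v) = 0") (simp_all add: power2_eq_square field_simps)
  qed
  show ?case using Suc 1[of "w * Q ^ s"] assms by (simp add: mult_ac)
qed simp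

lemma gen_fun_has_sum_small:
  fixes q z :: complex
  assumes q: "norm q < 1" "q \<noteq> 0" and z: "z \<noteq> 0" and r: "0 < r" "r < n" "2 * r \<noteq> n"
  shows "((\<lambda>T. \<Prod>m\<in>T. (2 + z + inverse z) * part_weight q m)
    has_sum gen_fun (q ^ n) (q ^ r) z) (Fpow (pm_parts r n))"
proof (rule has_sum_prod_subsets)
  let ?x = "2 + z + inverse z"
  let ?Q = "q ^ n"
  let ?w = "q ^ r"
  have Q: "norm ?Q < 1" "?Q \<noteq> 0" using q r by (auto simp: norm_power power_less_one_iff)
  have nd: "\<not> int n dvd int r" using r by (auto dest: zdvd_imp_le)
  have factor: "(1 + ?x * part_weight q (n * i + r)) * (1 + ?x * part_weight q (n * Suc i - r))
      = theta_factor ?Q (?w * z) i * theta_factor ?Q (?w * inverse z) i / (theta_factor ?Q (- ?w) i)\<^sup>2" for i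
  proof -
    \<comment> \<open>\<open>u\<close> and \<open>v\<close> belong to the two paired parts. The
      factor \<open>p\<close> occurs twice above and twice below the line and cancels.\<close>
    define u v p where "u = q ^ (n * i + r)" and "v = q ^ (n * Suc i - r)" and "p = 1 - ?Q ^ Suc i"
    have le: "r < n * Suc i" using r by (simp add: trans_less_add1)
    have wu: "?w * ?Q ^ i = u" by (simp add: u_def power_add power_mult)
    have wv: "inverse ?w * ?Q ^ Suc i = v"
      unfolding v_def power_mult[symmetric] using q le
      by (simp add: power_diff divide_inverse mult.commute del: mult_Suc_right)
    have nz: "1 - u \<noteq> 0" "1 - v \<noteq> 0" "p \<noteq> 0"
      using power_neq_one[OF q(1), of "n * i + r"] power_neq_one[OF q(1), of "n * Suc i - r"] r le
        power_neq_one[OF Q(1), of "Suc i"] by (auto simp: u_def v_def p_def)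
    \<comment> \<open>One formula serves all theta factors: y = z and y = 1/z in the numerator, y =
      -1 in the denominator.\<close>
    have *: "theta_factor ?Q (?w * y) i = p * (1 + u * y) * (1 + v * inverse y)" for y
      unfolding theta_factor_def p_def wu[symmetric] wv[symmetric] by (simp add: mult_ac)
    have "theta_factor ?Q (- ?w) i = p * (1 - u) * (1 - v)"
      using *[of "-1"] by simp
    moreover have "1 + ?x * (t / (1 - t)\<^sup>2) = (1 + t * z) * (1 + t * inverse z) / (1 - t)\<^sup>2" if "1 - t \<noteq> 0" for t
    proof -
      have "(1 - t)\<^sup>2 + ?x * t = (1 + t * z) * (1 + t * inverse z)"
        using z by (simp add: power2_eq_square field_simps)
      thus ?thesis using that by (simp add: field_simps)
    qed
    ultimately show ?thesis
      unfolding * part_weight_def u_def[symmetric] v_def[symmetric] using nz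
      by (simp add: power2_eq_square mult_ac)
  qed
  show "(\<lambda>M. \<Prod>m\<in>pm_parts_upto r n M. 1 + ?x * part_weight q m) \<longlonglongrightarrow> gen_fun ?Q ?w z"
    unfolding prod_pm_parts_upto[OF r] factor prod_dividef prod.distrib prod_power_distrib[symmetric] gen_fun_def
    using q z theta_minus_nonzero[OF q _ nd] r
    by (intro tendsto_intros jacobi_triple_product Q) auto
  show "(\<Union>M. pm_parts_upto r n M) = pm_parts r n" using r by (intro Union_pm_parts_upto)
  show "incseq (pm_parts_upto r n)" by (fastforce simp: incseq_def pm_parts_upto_def)
  show "finite (pm_parts_upto r n M)" for M by (simp add: pm_parts_upto_def)
qed (rule part_weight_abs_summable[OF q(1)])

text \<open>Reduces to r = l mod n. The set of parts and \<open>gen_fun\<close> do not change, by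
  \<open>pm_parts_mod\<close> and \<open>gen_fun_shift\<close>.\<close>

lemma gen_fun_has_sum:
  fixes q z :: complex
  assumes q: "norm q < 1" "q \<noteq> 0" and z: "z \<noteq> 0" and n: "0 < n"
    and l: "\<not> n dvd l" "\<not> n dvd 2 * l"
  shows "((\<lambda>T. \<Prod>m\<in>T. (2 + z + inverse z) * part_weight q m)
    has_sum gen_fun (q ^ n) (q ^ l) z) (Fpow (pm_parts l n))"
proof -
  define r where "r = l mod n"
  have r: "0 < r" "r < n"
    using l n by (auto simp: r_def mod_greater_zero_iff_not_dvd)
  have "2 * r \<noteq> n"
  proof
    assume "2 * r = n"
    hence "(2 * l) mod n = 0" unfolding r_def by (metis mod_mult_right_eq mod_self)
    thus False using l by blast
  qed
  have "norm (q ^ n) < 1" using q n by (simp add: norm_power power_less_one_iff)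
  moreover have "q ^ l = q ^ r * (q ^ n) ^ (l div n)"
    by (simp add: r_def flip: power_mult power_add)
  ultimately have "gen_fun (q ^ n) (q ^ l) z = gen_fun (q ^ n) (q ^ r) z"
    using q z by (simp add: gen_fun_shift)
  thus ?thesis
    using gen_fun_has_sum_small[OF q z r \<open>2 * r \<noteq> n\<close>] pm_parts_mod[of l n] by (simp add: r_def)
qed

section \<open>Comparison of coefficients\<close>

lemma has_sum_product_abs:
  fixes f :: "'a \<Rightarrow> complex" and g :: "'b \<Rightarrow> complex"
  assumes f: "(\<lambda>x. norm (f x)) summable_on A" "(f has_sum s) A"
    and g: "(\<lambda>y. norm (g y)) summable_on B" "(g has_sum t) B"
  shows "(\<lambda>p. norm (f (fst p) * g (snd p))) summable_on A \<times> B"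
    and "((\<lambda>p. f (fst p) * g (snd p)) has_sum s * t) (A \<times> B)"
proof -
  show summ: "(\<lambda>p. norm (f (fst p) * g (snd p))) summable_on A \<times> B"
  proof (rule summable_on_SigmaI)
    show "((\<lambda>y. norm (f (fst (x, y)) * g (snd (x, y)))) has_sum norm (f x) * (\<Sum>\<^sub>\<infinity>y\<in>B. norm (g y))) B" for x
      unfolding fst_conv snd_conv norm_mult by (intro has_sum_cmult_right has_sum_infsum g(1))
    show "(\<lambda>x. norm (f x) * (\<Sum>\<^sub>\<infinity>y\<in>B. norm (g y))) summable_on A"
      by (intro summable_on_cmult_left f(1))
  qed simp
  show "((\<lambda>p. f (fst p) * g (snd p)) has_sum s * t) (A \<times> B)"
  proof (rule has_sum_SigmaI)
    show "((\<lambda>y. f (fst (x, y)) * g (snd (x, y))) has_sum f x * t) B" for x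
      unfolding fst_conv snd_conv by (intro has_sum_cmult_right g(2))
    show "((\<lambda>x. f x * t) has_sum s * t) A"
      by (intro has_sum_cmult_left f(2))
    show "(\<lambda>p. f (fst p) * g (snd p)) summable_on A \<times> B"
      by (rule abs_summable_summable[OF summ])
  qed
qed

text \<open>The product of the two theta series is a double series over (r, s) in which z has
  exponent r - s, so the coefficient of z^j is the sum over the line s = r - j.\<close>

lemma fourier_coeff_gen_fun:
  assumes Q: "norm Q < 1" "Q \<noteq> 0" and w: "w \<noteq> 0"
  shows "fourier_coeff (gen_fun Q w) j
    = w powi (- j) * Q powi tri (- j) * (theta (Q\<^sup>2) (w\<^sup>2 * Q powi (- j)) / (theta Q (- w))\<^sup>2)"
proof -
  let ?D = "(theta Q (- w))\<^sup>2"
  let ?h = "\<lambda>r. Q powi tri r * w powi r"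
  let ?a = "\<lambda>p. inverse ?D * (?h (fst p) * ?h (snd p))"
  have "(\<lambda>p. norm (?h (fst p) * ?h (snd p))) summable_on UNIV \<times> UNIV"
    by (rule has_sum_product_abs theta_abs_summable theta_has_sum assms)+
  hence summ: "(\<lambda>p. norm (?a p)) summable_on UNIV \<times> UNIV"
    unfolding norm_mult[of "inverse ?D"] by (rule summable_on_cmult_right)
  have F: "((\<lambda>p. ?a p * z powi (fst p - snd p)) has_sum gen_fun Q w z) (UNIV \<times> UNIV)" if "norm z = 1" for z
  proof -
    have z: "z \<noteq> 0" using that by auto
    let ?f = "\<lambda>r. Q powi tri r * (w * z) powi r" and ?g = "\<lambda>r. Q powi tri r * (w * inverse z) powi r"
    have "((\<lambda>p. ?f (fst p) * ?g (snd p)) has_sum theta Q (w * z) * theta Q (w * inverse z)) (UNIV \<times> UNIV)"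
      using z w by (intro has_sum_product_abs theta_abs_summable theta_has_sum Q) auto
    hence "((\<lambda>p. inverse ?D * (?f (fst p) * ?g (snd p))) has_sum
        inverse ?D * (theta Q (w * z) * theta Q (w * inverse z))) (UNIV \<times> UNIV)"
      by (rule has_sum_cmult_right)
    moreover have "inverse ?D * (?f (fst p) * ?g (snd p)) = ?a p * z powi (fst p - snd p)" for p
      using z by (simp add: power_int_mult_distrib power_int_diff power_int_inverse divide_inverse mult_ac)
    ultimately have "((\<lambda>p. ?a p * z powi (fst p - snd p)) has_sum
        inverse ?D * (theta Q (w * z) * theta Q (w * inverse z))) (UNIV \<times> UNIV)"
      by (simp only:)
    thus ?thesis by (simp add: gen_fun_def divide_inverse mult.commute)
  qed
  have "(?a has_sum fourier_coeff (gen_fun Q w) j) {p \<in> UNIV \<times> UNIV. fst p - snd p = j}"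
    using summ F by (rule has_sum_fourier_coeff)
  also have "?this \<longleftrightarrow> ((\<lambda>r. ?a (r, r - j)) has_sum fourier_coeff (gen_fun Q w) j) UNIV"
    by (rule has_sum_reindex_bij_witness[of _ "\<lambda>r. (r, r - j)" fst]) auto
  also have "(\<lambda>r. ?a (r, r - j)) = (\<lambda>r. w powi (- j) * Q powi tri (- j) * inverse ?D
      * ((Q\<^sup>2) powi tri r * (w\<^sup>2 * Q powi (- j)) powi r))"
  proof
    fix r
    \<comment> \<open>Together with the factor \<open>Q powi tri r\<close> this gives the base Q^2,
      and the term - j r moves into the argument as Q^(-j).\<close>
    have "tri (r - j) = tri r + tri (- j) + (- j) * r"
      using tri_add[of r "- j"] by (simp add: mult.commute)
    hence "Q powi tri (r - j) = Q powi tri r * Q powi tri (- j) * (Q powi (- j)) powi r"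
      using Q by (simp add: power_int_add power_int_mult del: mult_minus_left)
    moreover have "w powi (r - j) = w powi r * w powi (- j)"
      using w power_int_add[of w r "- j"] by simp
    ultimately show "?a (r, r - j) = w powi (- j) * Q powi tri (- j) * inverse ?D
      * ((Q\<^sup>2) powi tri r * (w\<^sup>2 * Q powi (- j)) powi r)"
      by (simp add: power_int_mult_distrib power2_eq_square)
  qed
  finally have "((\<lambda>r. w powi (- j) * Q powi tri (- j) * inverse ?D
      * ((Q\<^sup>2) powi tri r * (w\<^sup>2 * Q powi (- j)) powi r)) has_sum fourier_coeff (gen_fun Q w) j) UNIV" .
  moreover have "((\<lambda>r. w powi (- j) * Q powi tri (- j) * inverse ?D
      * ((Q\<^sup>2) powi tri r * (w\<^sup>2 * Q powi (- j)) powi r)) has_sum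
      (w powi (- j) * Q powi tri (- j) * inverse ?D * theta (Q\<^sup>2) (w\<^sup>2 * Q powi (- j)))) UNIV"
    using Q w by (intro has_sum_cmult_right theta_has_sum) (auto simp: norm_power power_less_one_iff)
  ultimately show ?thesis
    by (simp add: has_sum_unique divide_inverse mult_ac)
qed

text \<open>Both sides equal (1 + z)^(2c) / z^c.\<close>

lemma sum_central_binomial:
  fixes z :: complex
  assumes "z \<noteq> 0"
  shows "(\<Sum>r\<le>2 * c. of_nat (2 * c choose r) * z powi (int r - int c)) = (2 + z + inverse z) ^ c"
proof -
  have "(\<Sum>r\<le>2 * c. of_nat (2 * c choose r) * z powi (int r - int c))
      = (\<Sum>r\<le>2 * c. of_nat (2 * c choose r) * z ^ r * 1 ^ (2 * c - r)) / z ^ c"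
    using assms by (simp add: power_int_diff sum_divide_distrib)
  also have "\<dots> = (z + 1) ^ (2 * c) / z ^ c"
    by (simp only: binomial_ring)
  also have "\<dots> = ((z + 1)\<^sup>2 / z) ^ c"
    by (simp add: power_divide power_mult)
  also have "(z + 1)\<^sup>2 / z = 2 + z + inverse z"
    using assms by (simp add: power2_eq_square field_simps)
  finally show ?thesis .
qed

text \<open>Each subset product is expanded in powers of z: the pair (T, r) with r <= 2 |T| carries
  the exponent r - |T|. Exponent j means r = j + |T|, and grouping by k = |T| produces
  \<open>macmahon_A\<close>.\<close>

lemma macmahon_A_fourier:
  assumes q: "norm q < 1" "q \<noteq> 0" and n: "0 < n" and l: "\<not> n dvd l" "\<not> n dvd 2 * l"
  shows "((\<lambda>k. of_nat (2 * k choose (j + k)) * macmahon_A l n k q)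
    has_sum fourier_coeff (gen_fun (q ^ n) (q ^ l)) (int j)) {j..}"
proof -
  let ?S = "Fpow (pm_parts l n)" and ?P = "\<lambda>T. \<Prod>m\<in>T. part_weight q m"
  let ?I = "Sigma ?S (\<lambda>T. {..2 * card T})"
  let ?a = "\<lambda>p. of_nat (2 * card (fst p) choose snd p) * ?P (fst p)"
  let ?e = "\<lambda>p. int (snd p) - int (card (fst p))"
  let ?C = "fourier_coeff (gen_fun (q ^ n) (q ^ l)) (int j)"
  have summ: "(\<lambda>p. norm (?a p)) summable_on ?I"
  proof (rule summable_on_SigmaI)
    \<comment> \<open>The binomials of the row add up to 2^(2 |T|) = 4^|T|, which is absorbed as a
      weight 4 on each part.\<close>
    show "((\<lambda>r. norm (?a (T, r))) has_sum norm (\<Prod>m\<in>T. 4 * part_weight q m)) {..2 * card T}" for T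
    proof (rule has_sum_finiteI)
      have "(\<Sum>r\<le>2 * card T. norm (?a (T, r))) = real (\<Sum>r\<le>2 * card T. 2 * card T choose r) * norm (?P T)"
        by (simp add: norm_mult sum_distrib_right)
      also have "\<dots> = 4 ^ card T * norm (?P T)"
        unfolding choose_row_sum by (simp add: power_mult)
      finally show "norm (\<Prod>m\<in>T. 4 * part_weight q m) = (\<Sum>r\<le>2 * card T. norm (?a (T, r)))"
        by (simp add: prod.distrib norm_mult norm_power)
    qed simp
    show "(\<lambda>T. norm (\<Prod>m\<in>T. 4 * part_weight q m)) summable_on ?S"
      by (intro abs_summable_prod_subsets part_weight_abs_summable q)
  qed simp
  have F: "((\<lambda>p. ?a p * z powi ?e p) has_sum gen_fun (q ^ n) (q ^ l) z) ?I" if "norm z = 1" for z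
  proof (rule has_sum_SigmaI)
    have z: "z \<noteq> 0" using that by auto
    show "((\<lambda>r. ?a (T, r) * z powi ?e (T, r)) has_sum (\<Prod>m\<in>T. (2 + z + inverse z) * part_weight q m)) {..2 * card T}" for T
    proof (rule has_sum_finiteI)
      have "(\<Sum>r\<le>2 * card T. ?a (T, r) * z powi ?e (T, r))
          = (\<Sum>r\<le>2 * card T. of_nat (2 * card T choose r) * z powi (int r - int (card T))) * ?P T"
        unfolding sum_distrib_right by (intro sum.cong) (simp_all add: mult_ac)
      thus "(\<Prod>m\<in>T. (2 + z + inverse z) * part_weight q m) = (\<Sum>r\<le>2 * card T. ?a (T, r) * z powi ?e (T, r))"
        unfolding sum_central_binomial[OF z] by (simp add: prod.distrib)
    qed simp
    show "((\<lambda>T. \<Prod>m\<in>T. (2 + z + inverse z) * part_weight q m) has_sum gen_fun (q ^ n) (q ^ l) z) ?S"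
      by (rule gen_fun_has_sum[OF q z n l])
    have "(\<lambda>p. norm (?a p * z powi ?e p)) summable_on ?I"
      using summ that by (simp add: norm_mult norm_power_int)
    thus "(\<lambda>p. ?a p * z powi ?e p) summable_on ?I" by (rule abs_summable_summable)
  qed
  have index: "r = j + c" if "int r - int c = int j" for r c
    using that by linarith
  have "(?a has_sum ?C) {p \<in> ?I. ?e p = int j}"
    using summ F by (rule has_sum_fourier_coeff)
  \<comment> \<open>The bound r <= 2 k with r = j + k says j <= k, hence the range
    \<open>{j..}\<close>.\<close>
  also have "?this \<longleftrightarrow> ((\<lambda>p. ?a (snd p, j + fst p)) has_sum ?C) (Sigma {j..} (\<lambda>k. {T \<in> ?S. card T = k}))"
    by (rule has_sum_reindex_bij_witness[of _ "\<lambda>(k, T). (T, j + k)" "\<lambda>(T, r). (card T, T)"])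
      (auto dest!: index)
  finally show ?thesis
  proof (rule has_sum_Sigma')
    fix k
    have "((\<lambda>T. of_nat (2 * k choose (j + k)) * ?P T) has_sum of_nat (2 * k choose (j + k)) * macmahon_A l n k q)
        {T \<in> ?S. card T = k}"
      by (intro has_sum_cmult_right macmahon_A_has_sum q)
    also have "?this \<longleftrightarrow> ((\<lambda>T. ?a (snd (k, T), j + fst (k, T))) has_sum
        of_nat (2 * k choose (j + k)) * macmahon_A l n k q) {T \<in> ?S. card T = k}"
      by (rule has_sum_cong) auto
    finally show "((\<lambda>T. ?a (snd (k, T), j + fst (k, T))) has_sum
        of_nat (2 * k choose (j + k)) * macmahon_A l n k q) {T \<in> ?S. card T = k}" .
  qed
qed

section \<open>The product side\<close>

lemma shift_exponent_eq: "shift_exponent l n j = n * tri (- j) - l * j"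
proof -
  have "j * (j * n - 2 * l + n) = 2 * (n * tri (- j) - l * j)"
    using two_tri[of "- j"] by (simp add: algebra_simps)
  thus ?thesis by (simp add: shift_exponent_def)
qed

text \<open>From q^e = -1 it would follow that q^(2e) = 1, hence e = 0, where the sum is 2.\<close>

lemma one_plus_power_int_nonzero:
  fixes q :: complex
  assumes "norm q < 1" "q \<noteq> 0"
  shows "1 + q powi e \<noteq> 0"
proof
  assume h: "1 + q powi e = 0"
  have "q powi (2 * e) = (q powi e)\<^sup>2"
    using assms by (simp add: power2_eq_square flip: power_int_add)
  also have "q powi e = - 1" using h by (simp add: add_eq_0_iff)
  finally have "e = 0" using power_int_neq_one[OF assms, of "2 * e"] by auto
  thus False using h by simp
qed

text \<open>With m = i + 1, the numerator factor 1 - Q^(2m) = (1 - Q^m) (1 + Q^m) cancels one of the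
  two factors 1 - Q^m below and leaves 1 + Q^m above.\<close>

lemma prod_factor_eq:
  fixes q :: complex
  assumes q: "q \<noteq> 0"
  shows "prod_factor q (int l) (int n) j (int (Suc i))
    = theta_factor ((q ^ n)\<^sup>2) ((q ^ l)\<^sup>2 * (q ^ n) powi (- j)) i / (theta_factor (q ^ n) (- (q ^ l)) i)\<^sup>2"
proof -
  define R where "R = int n * int i"
  have pw: "q ^ m = q powi int m" for m by simp
  have Q: "(q ^ n) ^ i = q powi R" "(q ^ n) ^ Suc i = q powi (int n + R)"
    unfolding R_def pw using q
    by (simp_all add: power_int_add power_mult flip: of_nat_mult)
  have Q2: "((q ^ n)\<^sup>2) ^ k = ((q ^ n) ^ k)\<^sup>2" for k by (simp add: mult_ac flip: power_mult)
  have sq: "(q powi k)\<^sup>2 = q powi (2 * k)" for k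
    using q by (simp add: power2_eq_square flip: power_int_add)
  have w: "q ^ l = q powi int l" "(q ^ n) powi (- j) = q powi (- (int n * j))"
    by (simp_all add: power_int_mult power_int_minus)
  have e: "int n * int (Suc i) = int n + R" "2 * int n * int (Suc i) = 2 * (int n + R)"
    by (simp_all add: R_def algebra_simps)
  define a where "a = q powi (int n + R)"
  have "inverse ((q ^ l)\<^sup>2 * (q ^ n) powi (- j)) * ((q ^ n)\<^sup>2) ^ Suc i
      = q powi (2 * (int n + R) + int n * j - 2 * int l)"
    unfolding Q2 Q w sq power_int_add[OF disjI1[OF q], symmetric] power_int_minus[symmetric]
    by (simp add: algebra_simps)
  moreover have "(q ^ l)\<^sup>2 * (q ^ n) powi (- j) * ((q ^ n)\<^sup>2) ^ i
      = q powi (2 * (int n + R) - int n * (j + 2) + 2 * int l)"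
    unfolding Q2 Q w sq power_int_add[OF disjI1[OF q], symmetric] by (simp add: algebra_simps)
  moreover have "- (q ^ l) * (q ^ n) ^ i = - (q powi (int n + R + int l - int n))"
    unfolding Q w mult_minus_left power_int_add[OF disjI1[OF q], symmetric] by (simp add: algebra_simps)
  moreover have "inverse (- (q ^ l)) * (q ^ n) ^ Suc i = - (q powi (int n + R - int l))"
    unfolding Q w inverse_minus_eq mult_minus_left power_int_minus[symmetric]
      power_int_add[OF disjI1[OF q], symmetric] by (simp add: algebra_simps)
  moreover have "((q ^ n)\<^sup>2) ^ Suc i = a\<^sup>2" "(q ^ n) ^ Suc i = a"
    unfolding Q2 Q a_def by simp_all
  \<comment> \<open>For a = 1 both denominators are 0, so both sides are 0 by convention.\<close>
  moreover have "(1 + a) * x * y / ((1 - a) * u\<^sup>2 * v\<^sup>2) = (1 - a\<^sup>2) * x * y / ((1 - a) * u * v)\<^sup>2" for x y u v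
  proof (cases "a = 1")
    case False
    have "1 - a\<^sup>2 = (1 - a) * (1 + a)" by (simp add: power2_eq_square algebra_simps)
    thus ?thesis using False by (simp add: power2_eq_square mult_ac)
  qed simp
  ultimately show ?thesis
    unfolding prod_factor_def theta_factor_def e a_def[symmetric]
    by (simp only: diff_conv_add_uminus[symmetric])
qed

lemma prod_factor_product:
  fixes q :: complex and j :: int
  assumes q: "norm q < 1" "q \<noteq> 0" and n: "0 < n" and l: "\<not> n dvd l"
  defines "f \<equiv> \<lambda>i. prod_factor q (int l) (int n) j (int (Suc i))"
  shows "convergent_prod f"
    and "prodinf f = theta ((q ^ n)\<^sup>2) ((q ^ l)\<^sup>2 * (q ^ n) powi (- j)) / (theta (q ^ n) (- (q ^ l)))\<^sup>2"
proof -
  let ?Q = "q ^ n" and ?w = "q ^ l" and ?v = "(q ^ l)\<^sup>2 * (q ^ n) powi (- j)"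
  have Q: "norm ?Q < 1" "?Q \<noteq> 0" "norm (?Q\<^sup>2) < 1" "?Q\<^sup>2 \<noteq> 0"
    using q n by (simp_all add: norm_power power_less_one_iff)
  have v: "?v = q powi (2 * int l - int n * j)"
    using q by (simp add: power_int_diff power_int_mult power_int_minus divide_inverse
        power_mult power_mult_distrib[symmetric] power2_eq_square)
  have num: "theta_factor (?Q\<^sup>2) ?v i \<noteq> 0" for i
  proof -
    have "(?Q\<^sup>2) ^ i = q powi int (n * 2 * i)" "(?Q\<^sup>2) ^ Suc i = q powi int (n * 2 * Suc i)"
      unfolding power_int_of_nat power_mult by simp_all
    hence "?v * (?Q\<^sup>2) ^ i = q powi (2 * int l - int n * j + int (n * 2 * i))"
      "inverse ?v * (?Q\<^sup>2) ^ Suc i = q powi (- (2 * int l - int n * j) + int (n * 2 * Suc i))"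
      unfolding v power_int_minus[symmetric] using q by (simp_all only: power_int_add simp_thms)
    thus ?thesis
      using one_plus_power_int_nonzero[OF q] power_neq_one[OF Q(3), of "Suc i"]
      by (simp add: theta_factor_def del: power_Suc)
  qed
  have nd: "\<not> int n dvd int l" using l by simp
  have den: "theta_factor ?Q (- ?w) i \<noteq> 0" for i
    using theta_factor_minus_nonzero[OF q n nd] by simp
  have f: "f i = theta_factor (?Q\<^sup>2) ?v i / (theta_factor ?Q (- ?w) i)\<^sup>2" for i
    unfolding f_def by (rule prod_factor_eq[OF q(2)])
  let ?L = "theta (?Q\<^sup>2) ?v / (theta ?Q (- ?w))\<^sup>2"
  have L: "theta (?Q\<^sup>2) ?v \<noteq> 0" "theta ?Q (- ?w) \<noteq> 0"
    using theta_nonzero[OF Q(3,4) _ num] theta_minus_nonzero[OF q n nd] q by auto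
  have "(\<lambda>M. \<Prod>i<M. f i) \<longlonglongrightarrow> ?L"
    unfolding f prod_dividef prod_power_distrib[symmetric]
    using Q q L by (intro tendsto_divide tendsto_power jacobi_triple_product) auto
  hence lim: "(\<lambda>M. \<Prod>i\<le>M. f i) \<longlonglongrightarrow> ?L"
    by (simp add: LIMSEQ_lessThan_iff_atMost)
  moreover have nz: "?L \<noteq> 0" using L by simp
  moreover have "f i \<noteq> 0" for i using num den by (simp add: f)
  \<comment> \<open>Since no factor vanishes, convergence of the infinite product amounts to a
    nonzero limit of the partial products.\<close>
  ultimately show "convergent_prod f"
    using convergent_prod_iff_nz_lim by blast
  show "prodinf f = ?L" by (rule prodinf_eq_prod_lim[OF lim nz])
qed

section \<open>The case q = 0 and the final identity\<close>

lemma macmahon_A_zero_right: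
  "macmahon_A l n k 0 = (if k = 0 then 1 else 0)"
proof (cases k)
  case 0
  have "pm_tuples l n 0 = {[]}" by (auto simp: pm_tuples_def)
  thus ?thesis using 0 by (simp add: macmahon_A_def)
next
  case (Suc k')
  have "(0::complex) ^ sum_list ms / (\<Prod>m\<leftarrow>ms. (1 - 0 ^ m)\<^sup>2) = 0" if "ms \<in> pm_tuples l n k" for ms
    using that Suc by (cases ms) (auto simp: pm_tuples_def)
  thus ?thesis using Suc by (simp add: macmahon_A_def infsum_0)
qed

text \<open>Every exponent is positive, already at m = 1, so all the powers of 0 are 0.\<close>

lemma prod_factor_zero:
  assumes "0 < l" "l < n"
  shows "prod_factor 0 (int l) (int n) 0 (int (Suc i)) = 1"
proof -
  have "int n \<le> int n * int (Suc i)" by (simp add: algebra_simps)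
  hence "int n * int (Suc i) \<noteq> 0" "2 * int n * int (Suc i) - int n * (0 + 2) + 2 * int l \<noteq> 0"
    "2 * int n * int (Suc i) + int n * 0 - 2 * int l \<noteq> 0" "int n * int (Suc i) + int l - int n \<noteq> 0"
    "int n * int (Suc i) - int l \<noteq> 0"
    using assms unfolding mult.assoc[of 2] by (simp_all only: distrib_left mult_zero_right)
  thus ?thesis unfolding prod_factor_def by (simp only: power_int_0_left not_False_eq_True) simp
qed

text \<open>The conditions on l are read modulo n. If n divides l, the factor with n m = l has a
  vanishing denominator; if l and - l are congruent, the two residue classes coincide while the
  product still counts both. For q = 0, the restriction to j = 0 and l < n keeps the exponents in
  the factors positive.\<close>

theorem theorem1p6:
  fixes n l j :: nat and q :: complex
  assumes "n > 0" and "l > 0"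
    and "\<not> [l = n] (mod n)" and "\<not> [2 * l = n] (mod n)"
    and "norm q < 1"
    and "q \<noteq> 0 \<or> (j = 0 \<and> l < n)"
  shows "convergent_prod (\<lambda>i. prod_factor q (int l) (int n) (int j) (int (Suc i)))
    \<and> (\<lambda>k. of_nat ((2 * k) choose (j + k)) * macmahon_A l n k q) summable_on {j..}
    \<and> (\<Prod>i. prod_factor q (int l) (int n) (int j) (int (Suc i)))
        = q powi (- shift_exponent (int l) (int n) (int j))
          * (\<Sum>\<^sub>\<infinity>k\<in>{j..}. of_nat ((2 * k) choose (j + k)) * macmahon_A l n k q)"
proof (cases "q = 0")
  case True
  hence j: "j = 0" and l: "l < n" using assms by auto
  \<comment> \<open>At q = 0 only the empty tuple contributes, that is, only k = 0.\<close>
  have "((\<lambda>k. of_nat ((2 * k) choose (j + k)) * macmahon_A l n k q) has_sum 1) {j..}"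
    by (rule has_sum_finite_neutralI[of "{0}"]) (auto simp: True j macmahon_A_zero_right)
  thus ?thesis
    using prod_factor_zero[OF assms(2) l]
    by (simp add: True j has_sum_iff shift_exponent_def del: of_nat_Suc)
next
  case False
  have nd: "\<not> n dvd l" "\<not> n dvd 2 * l"
    using assms(3,4) by (auto simp: cong_def)
  note q = assms(5) False
  let ?A = "\<lambda>k. of_nat ((2 * k) choose (j + k)) * macmahon_A l n k q"
  let ?C = "fourier_coeff (gen_fun (q ^ n) (q ^ l)) (int j)"
  let ?f = "\<lambda>i. prod_factor q (int l) (int n) (int j) (int (Suc i))"
  have A: "(?A has_sum ?C) {j..}"
    by (rule macmahon_A_fourier[OF q assms(1) nd])
  have "norm (q ^ n) < 1" using assms(1) q by (simp add: norm_power power_less_one_iff)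
  hence "?C = (q ^ l) powi (- int j) * (q ^ n) powi tri (- int j) * prodinf ?f"
    using fourier_coeff_gen_fun[of "q ^ n" "q ^ l" "int j"] False
    by (simp only: prod_factor_product(2)[OF q assms(1) nd(1)] power_not_zero not_False_eq_True)
  \<comment> \<open>The monomial in front of the theta quotient has exponent n tri (-j) - l j, the
    shift exponent; it moves to the other side with opposite sign.\<close>
  also have "(q ^ l) powi (- int j) * (q ^ n) powi tri (- int j)
      = q powi shift_exponent (int l) (int n) (int j)"
    unfolding shift_exponent_eq power_int_diff[OF disjI1[OF False]] power_int_mult
    by (simp add: power_int_minus divide_inverse mult.commute)
  finally have "prodinf ?f = q powi (- shift_exponent (int l) (int n) (int j)) * ?C"
    using False by (simp add: power_int_minus)
  thus ?thesis
    using A prod_factor_product(1)[OF q assms(1) nd(1)] by (simp add: has_sum_iff)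
qed

end
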